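(* In the online setting, assume that the null $p$-values are conditionally super-uniform: $\mathbf P(p_k\le x\mid\mathcal G_{k-1})\le x$ for all $x\in[0,1]$ and $k\in\mathcal H_0$. For any online procedure $\mathcal A=(\alpha_k,k\ge1)$, let $R_k=\{1\le i\le k:p_i\le\alpha_i\}$ and $R(k)=|R_k|$. Then for any $\delta\in(0,1)$, setting $$\overline{\mathrm{FDP}}^{\mathrm{KR\text{-}U}}_{\mathcal A,k}=1\wedge\min_{a\in\mathbb N\setminus\{0\}}\left\{\frac{\log(1/\delta_a)}{a\log\bigl(1+\log(1/\delta_a)/a\bigr)}\cdot\frac{a+\sum_{i=1}^k\alpha_i}{1\vee R(k)}\right\},\qquad k\ge1,$$ where $\delta_a=\delta/(\kappa a^2)$ for $a\ge1$ and $\kappa=\pi^2/6$, one has $$\mathbf P\bigl(\forall k\ge1,\ \mathrm{FDP}(R_k)\le\overline{\mathrm{FDP}}^{\mathrm{KR\text{-}U}}_{\mathcal A,k}\bigr)\ge1-\delta.$$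
   Context: Online setting: $p_1,p_2,\dots$ is an infinite sequence of $[0,1]$-valued $p$-values for null hypotheses $H_1,H_2,\dots$; $\mathcal H_0\subset\{1,2,\dots\}$ is the (fixed) set of indices of true nulls. An online procedure is a sequence $\mathcal A=(\alpha_k,k\ge1)$ of $[0,1]$-valued critical values, rejecting $H_k$ if $p_k\le\alpha_k$, that is predictable: $\alpha_{k+1}$ is measurable with respect to $\mathcal G_k=\sigma(\mathbf 1\{p_i\le\alpha_i\},i\le k)$ for $k\ge0$ ($\mathcal G_0$ trivial, so $\alpha_1$ is deterministic). $\mathrm{FDP}(R)=|R\cap\mathcal H_0|/(|R|\vee1)$. *)

theory Defs
  imports "HOL-Probability.Probability"
begin

definition generated_sigma :: "'a measure \<Rightarrow> nat set \<Rightarrow> (nat \<Rightarrow> 'a \<Rightarrow> real) \<Rightarrow> 'a measure" where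
  "generated_sigma M I X =
     sigma (space M) (\<Union>i\<in>I. {X i -` B \<inter> space M |B. B \<in> sets borel})"

(* Hypotheses are numbered from 1; the values of p and alpha at index 0 are never used. *)

definition decision_sigma ::
  "'a measure \<Rightarrow> (nat \<Rightarrow> 'a \<Rightarrow> real) \<Rightarrow> (nat \<Rightarrow> 'a \<Rightarrow> real) \<Rightarrow> nat \<Rightarrow> 'a measure" where
  "decision_sigma M p \<alpha> k =
     generated_sigma M {1..k} (\<lambda>i \<omega>. of_bool (p i \<omega> \<le> \<alpha> i \<omega>))"

definition pvalue_sequence :: "'a measure \<Rightarrow> (nat \<Rightarrow> 'a \<Rightarrow> real) \<Rightarrow> bool" where
  "pvalue_sequence M p \<longleftrightarrow>
     (\<forall>k\<ge>1. p k \<in> borel_measurable M \<and> (\<forall>\<omega>\<in>space M. p k \<omega> \<in> {0..1}))"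

definition online_procedure ::
  "'a measure \<Rightarrow> (nat \<Rightarrow> 'a \<Rightarrow> real) \<Rightarrow> (nat \<Rightarrow> 'a \<Rightarrow> real) \<Rightarrow> bool" where
  "online_procedure M p \<alpha> \<longleftrightarrow>
     (\<forall>k\<ge>1. \<forall>\<omega>\<in>space M. \<alpha> k \<omega> \<in> {0..1}) \<and>
     (\<forall>k. \<alpha> (Suc k) \<in> borel_measurable (decision_sigma M p \<alpha> k))"

definition cond_super_uniform ::
  "'a measure \<Rightarrow> (nat \<Rightarrow> 'a \<Rightarrow> real) \<Rightarrow> (nat \<Rightarrow> 'a \<Rightarrow> real) \<Rightarrow> nat set \<Rightarrow> bool" where
  "cond_super_uniform M p \<alpha> H0 \<longleftrightarrow>
     (\<forall>k\<in>H0. \<forall>x\<in>{0..1}. AE \<omega> in M.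
        real_cond_exp M (decision_sigma M p \<alpha> (k - 1))
          (indicator {\<omega> \<in> space M. p k \<omega> \<le> x}) \<omega> \<le> x)"

definition rejections ::
  "(nat \<Rightarrow> 'a \<Rightarrow> real) \<Rightarrow> (nat \<Rightarrow> 'a \<Rightarrow> real) \<Rightarrow> nat \<Rightarrow> 'a \<Rightarrow> nat set" where
  "rejections p \<alpha> k \<omega> = {i \<in> {1..k}. p i \<omega> \<le> \<alpha> i \<omega>}"

definition FDP :: "nat set \<Rightarrow> nat set \<Rightarrow> real" where
  "FDP H0 R = real (card (R \<inter> H0)) / real (max (card R) 1)"

definition delta_seq :: "real \<Rightarrow> nat \<Rightarrow> real" where
  "delta_seq \<delta> a = \<delta> / (pi\<^sup>2 / 6 * (real a)\<^sup>2)"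

definition KRU_term :: "real \<Rightarrow> real \<Rightarrow> nat \<Rightarrow> nat \<Rightarrow> real" where
  "KRU_term \<delta> s r a =
     ln (1 / delta_seq \<delta> a) / (real a * ln (1 + ln (1 / delta_seq \<delta> a) / real a))
       * ((real a + s) / real (max 1 r))"

(* The minimum over all a >= 1 is written as an infimum, because Min is only meaningful
   for finite sets; lemma KRU_min_attained shows that the infimum is a minimum. *)
definition KRU_bound ::
  "real \<Rightarrow> (nat \<Rightarrow> 'a \<Rightarrow> real) \<Rightarrow> (nat \<Rightarrow> 'a \<Rightarrow> real) \<Rightarrow> nat \<Rightarrow> 'a \<Rightarrow> real" where
  "KRU_bound \<delta> p \<alpha> k \<omega> =
     min 1 (INF a\<in>{1..}. KRU_term \<delta> (\<Sum>i=1..k. \<alpha> i \<omega>) (card (rejections p \<alpha> k \<omega>)) a)"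

lemma delta_seq_bounds:
  assumes "0 < \<delta>" "\<delta> < 1" "1 \<le> a"
  shows "0 < delta_seq \<delta> a" "delta_seq \<delta> a < 1"
proof -
  have "3\<^sup>2 < pi\<^sup>2" using pi_gt3 by (intro power_strict_mono) auto
  then have k: "1 < pi\<^sup>2 / 6" by simp
  have a: "1 \<le> (real a)\<^sup>2" using assms(3) by (simp add: one_le_power)
  have "1 * 1 \<le> pi\<^sup>2 / 6 * (real a)\<^sup>2" using k a by (intro mult_mono) auto
  then have d: "1 \<le> pi\<^sup>2 / 6 * (real a)\<^sup>2" by simp
  show "0 < delta_seq \<delta> a"
    unfolding delta_seq_def using assms(1) d by (intro divide_pos_pos) linarith+
  show "delta_seq \<delta> a < 1"
    unfolding delta_seq_def using assms(2) d by (subst pos_divide_less_eq) linarith+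
qed

lemma KRU_term_ge:
  assumes "0 < \<delta>" "\<delta> < 1" "0 \<le> s" "1 \<le> a"
  shows "real a / real (max 1 r) \<le> KRU_term \<delta> s r a"
proof -
  define L where "L = ln (1 / delta_seq \<delta> a)"
  have L: "0 < L"
    unfolding L_def using delta_seq_bounds[OF assms(1,2,4)] by (intro ln_gt_zero) simp
  have a: "0 < real a" using assms(4) by simp
  have x: "0 < L / real a" using L a by simp
  have den: "0 < real a * ln (1 + L / real a)" using a x by simp
  have "ln (1 + L / real a) \<le> L / real a" using x by (intro ln_add_one_self_le_self) simp
  then have "real a * ln (1 + L / real a) \<le> L" using a by (simp add: field_simps)
  then have c: "1 \<le> L / (real a * ln (1 + L / real a))" using den by simp
  have "1 * (real a / real (max 1 r))
          \<le> L / (real a * ln (1 + L / real a)) * ((real a + s) / real (max 1 r))"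
    using c assms(3) by (intro mult_mono divide_right_mono) auto
  then show ?thesis by (simp add: KRU_term_def L_def)
qed

lemma KRU_min_attained:
  assumes "0 < \<delta>" "\<delta> < 1" "0 \<le> s"
  shows "\<exists>a\<ge>1. (INF b\<in>{1..}. KRU_term \<delta> s r b) = KRU_term \<delta> s r a \<and>
                (\<forall>b\<ge>1. KRU_term \<delta> s r a \<le> KRU_term \<delta> s r b)"
proof -
  let ?T = "KRU_term \<delta> s r"
  define A where "A = {a. 1 \<le> a \<and> ?T a \<le> ?T 1}"
  have "A \<subseteq> {..nat \<lceil>?T 1 * real (max 1 r)\<rceil>}"
  proof
    fix a assume "a \<in> A"
    then have "real a / real (max 1 r) \<le> ?T 1"
      using KRU_term_ge[OF assms, of a r] by (auto simp: A_def)
    then have "real a \<le> ?T 1 * real (max 1 r)" by (subst (asm) pos_divide_le_eq) auto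
    then show "a \<in> {..nat \<lceil>?T 1 * real (max 1 r)\<rceil>}"
      unfolding atMost_iff by linarith
  qed
  then have fin: "finite A" by (rule finite_subset) simp
  have ne: "1 \<in> A" by (simp add: A_def)
  obtain a where a: "a \<in> A" "\<And>b. b \<in> A \<Longrightarrow> ?T a \<le> ?T b"
    using arg_min_if_finite(1)[OF fin, of ?T] arg_min_least[OF fin, of _ ?T] ne by blast
  have le: "?T a \<le> ?T b" if "1 \<le> b" for b
    using a(2)[of b] a(2)[OF ne] that by (cases "?T b \<le> ?T 1") (auto simp: A_def)
  have "1 \<le> a" using a(1) by (simp add: A_def)
  moreover have "(INF b\<in>{1..}. ?T b) = ?T a"
    using le \<open>1 \<le> a\<close> by (intro cInf_eq_minimum) auto
  ultimately show ?thesis using le by blast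
qed

end

theory Submission
  imports Defs
begin

text \<open>For \<open>\<theta> \<ge> 0\<close> let \<open>V\<^sub>k\<close> be the number of false rejections up to time \<open>k\<close> and \<open>S\<^sub>k\<close> the sum of the
  first \<open>k\<close> critical values. Conditional super-uniformity makes
  \<open>exp (\<theta> V\<^sub>k - (exp \<theta> - 1) S\<^sub>k)\<close> a nonnegative supermartingale starting at \<open>1\<close>, so Ville's maximal
  inequality bounds by \<open>\<delta>\<^sub>a\<close> the probability that it ever reaches \<open>1 / \<delta>\<^sub>a\<close>. The choice
  \<open>\<theta> = ln (1 + ln (1 / \<delta>\<^sub>a) / a)\<close> turns this into a linear bound on \<open>V\<^sub>k\<close> in terms of
  \<open>a + S\<^sub>k\<close>, uniform in \<open>k\<close>, and \<open>\<Sum>\<^sub>a \<delta>\<^sub>a = \<delta>\<close> allows a union bound over \<open>a\<close>.\<close>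

section \<open>Maximal inequality and predictable thresholds in a general probability space\<close>

text \<open>Stopping at level \<open>l\<close> is encoded by the events \<open>B n\<close> that the
  level has not been reached up to time \<open>n\<close>: off \<open>B n\<close> the value is frozen
  at \<open>l\<close>, on \<open>B n\<close> it is \<open>Z n\<close>. The mean of this frozen
  process never exceeds that of \<open>Z 0\<close>. The supermartingale property is assumed as an
  integral inequality over sets of \<open>F n\<close>, the form in which it is applied to
  \<open>B n\<close>.\<close>

lemma (in prob_space) ville_inequality:
  fixes Z :: "nat \<Rightarrow> 'a \<Rightarrow> real"
  assumes sub: "\<And>n. subalgebra M (F n)"
    and mono: "\<And>n. sets (F n) \<subseteq> sets (F (Suc n))"
    and adapted: "\<And>n. Z n \<in> borel_measurable (F n)"
    and nonneg: "\<And>n \<omega>. 0 \<le> Z n \<omega>"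
    and int: "\<And>n. integrable M (Z n)"
    and super: "\<And>n A. A \<in> sets (F n) \<Longrightarrow>
      (\<integral>\<omega>. indicator A \<omega> * Z (Suc n) \<omega> \<partial>M) \<le> (\<integral>\<omega>. indicator A \<omega> * Z n \<omega> \<partial>M)"
    and l: "0 < l"
  shows "l * prob {\<omega> \<in> space M. \<exists>n. l \<le> Z n \<omega>} \<le> expectation (Z 0)"
proof -
  define B where "B n = {\<omega> \<in> space M. \<forall>j\<le>n. Z j \<omega> < l}" for n
  have spF: "space (F n) = space M" for n using sub[of n] by (simp add: subalgebra_def)
  have lev: "{\<omega> \<in> space M. Z n \<omega> < l} \<in> sets (F n)" for n
    using adapted[of n] unfolding spF[of n, symmetric] by measurable
  have B_Suc: "B (Suc n) = B n \<inter> {\<omega> \<in> space M. Z (Suc n) \<omega> < l}" for n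
    by (auto simp: B_def le_Suc_eq)
  have BF: "B n \<in> sets (F n)" for n
  proof (induction n)
    case 0
    then show ?case using lev[of 0] by (simp add: B_def)
  next
    case (Suc n)
    then show ?case unfolding B_Suc using lev[of "Suc n"] mono[of n] by auto
  qed
  have BM [measurable]: "B n \<in> sets M" for n
    using BF[of n] sub[of n] by (auto simp: subalgebra_def)
  have Zm [measurable]: "Z n \<in> borel_measurable M" for n using int[of n] by auto
  have intB: "integrable M (\<lambda>\<omega>. indicator (B n) \<omega> * Z m \<omega>)" for n m
    using integrable_real_mult_indicator[OF BM int] by (simp add: mult.commute)
  have intC: "integrable M (indicator (space M - B n) :: 'a \<Rightarrow> real)" for n
    by (rule integrable_real_indicator) (auto simp: less_top[symmetric])
  have split: "(\<integral>\<omega>. l * indicator (space M - B n) \<omega> + indicator (B n) \<omega> * Z m \<omega> \<partial>M)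
      = l * prob (space M - B n) + (\<integral>\<omega>. indicator (B n) \<omega> * Z m \<omega> \<partial>M)" for n m
    using intB[of n m] intC[of n] by (subst Bochner_Integration.integral_add) auto
  have inti: "integrable M (\<lambda>\<omega>. l * indicator (space M - B n) \<omega> + indicator (B n) \<omega> * Z m \<omega>)" for n m
    using intB[of n m] intC[of n] by auto
  have main: "l * prob (space M - B n) + (\<integral>\<omega>. indicator (B n) \<omega> * Z n \<omega> \<partial>M) \<le> expectation (Z 0)" for n
  proof (induction n)
    case 0
    show ?case unfolding split[symmetric]
      using inti[of 0 0] int[of 0]
      by (intro integral_mono) (auto simp: B_def indicator_def)
  next
    case (Suc n)
    \<comment> \<open>On \<open>B n - B (Suc n)\<close> the process has just reached
      \<open>l\<close>, so freezing it there at \<open>l\<close> can only lower the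
      integral.\<close>
    have "l * prob (space M - B (Suc n)) + (\<integral>\<omega>. indicator (B (Suc n)) \<omega> * Z (Suc n) \<omega> \<partial>M)
        \<le> l * prob (space M - B n) + (\<integral>\<omega>. indicator (B n) \<omega> * Z (Suc n) \<omega> \<partial>M)"
      unfolding split[symmetric]
      by (rule integral_mono[OF inti inti]) (auto simp: B_Suc indicator_def)
    also have "\<dots> \<le> l * prob (space M - B n) + (\<integral>\<omega>. indicator (B n) \<omega> * Z n \<omega> \<partial>M)"
      using super[OF BF[of n]] by simp
    finally show ?case using Suc by simp
  qed
  have bound: "l * prob (space M - B n) \<le> expectation (Z 0)" for n
  proof -
    have "0 \<le> (\<integral>\<omega>. indicator (B n) \<omega> * Z n \<omega> \<partial>M)"
      by (intro Bochner_Integration.integral_nonneg) (auto simp: nonneg)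
    then show ?thesis using main[of n] by linarith
  qed
  \<comment> \<open>Continuity from below carries the bound from finite horizons to the infinite
    one.\<close>
  have "incseq (\<lambda>n. space M - B n)" by (rule incseq_SucI) (auto simp: B_Suc)
  then have "(\<lambda>n. prob (space M - B n)) \<longlonglongrightarrow> prob (\<Union>n. space M - B n)"
    by (intro finite_Lim_measure_incseq) auto
  then have "(\<lambda>n. l * prob (space M - B n)) \<longlonglongrightarrow> l * prob (\<Union>n. space M - B n)"
    by (intro tendsto_mult_left)
  then have "l * prob (\<Union>n. space M - B n) \<le> expectation (Z 0)"
    by (rule LIMSEQ_le_const2) (use bound in auto)
  moreover have "(\<Union>n. space M - B n) = {\<omega> \<in> space M. \<exists>n. l \<le> Z n \<omega>}"
    by (auto simp: B_def not_less) (meson le_refl not_le)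
  ultimately show ?thesis by simp
qed

text \<open>The hypothesis bounds the conditional distribution function at deterministic points only.
  Rounding \<open>\<alpha>\<close> up to a multiple of \<open>1 / N\<close> reduces a random threshold to
  finitely many deterministic ones.\<close>
lemma (in prob_space) super_uniform_predictable_threshold:
  fixes q \<alpha> f :: "'a \<Rightarrow> real"
  assumes sub: "subalgebra M F"
    and q [measurable]: "q \<in> borel_measurable M"
    and su: "\<And>x. x \<in> {0..1} \<Longrightarrow>
      AE \<omega> in M. real_cond_exp M F (indicator {\<omega> \<in> space M. q \<omega> \<le> x}) \<omega> \<le> x"
    and \<alpha>F: "\<alpha> \<in> borel_measurable F"
    and \<alpha>01: "\<And>\<omega>. \<omega> \<in> space M \<Longrightarrow> \<alpha> \<omega> \<in> {0..1}"
    and fF: "f \<in> borel_measurable F"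
    and f0: "\<And>\<omega>. 0 \<le> f \<omega>"
    and intf: "integrable M f"
  shows "(\<integral>\<omega>. f \<omega> * of_bool (q \<omega> \<le> \<alpha> \<omega>) \<partial>M) \<le> (\<integral>\<omega>. f \<omega> * \<alpha> \<omega> \<partial>M)"
proof -
  interpret finite_measure_subalgebra M F by unfold_locales (rule sub)
  have spF: "space F = space M" using sub by (simp add: subalgebra_def)
  have [measurable]: "\<alpha> \<in> borel_measurable M" "f \<in> borel_measurable M"
    using \<alpha>F fF sub by (auto intro: measurable_from_subalg)
  have int\<alpha>: "integrable M (\<lambda>\<omega>. f \<omega> * \<alpha> \<omega>)"
    by (rule Bochner_Integration.integrable_bound[OF intf])
      (use \<alpha>01 f0 in \<open>auto simp: abs_mult intro!: AE_I2 mult_left_le\<close>)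
  \<comment> \<open>A grid of mesh \<open>1 / N\<close> costs at most
    \<open>expectation f / N\<close>, which vanishes in the limit.\<close>
  have step: "(\<integral>\<omega>. f \<omega> * of_bool (q \<omega> \<le> \<alpha> \<omega>) \<partial>M)
      \<le> (\<integral>\<omega>. f \<omega> * \<alpha> \<omega> \<partial>M) + expectation f / real N" if N: "0 < N" for N
  proof -
    \<comment> \<open>\<open>E j\<close> is the cell on which \<alpha>, rounded up to the grid,
      equals \<open>j / N\<close>. It belongs to \<open>F\<close>, so the weight \<open>g j\<close>
      stays \<open>F\<close>-measurable; on it, \<open>q \<omega> \<le> \<alpha> \<omega>\<close>
      implies membership in \<open>Q j\<close>, whose threshold is deterministic.\<close>
    define E where "E j = {\<omega> \<in> space M. \<lceil>real N * \<alpha> \<omega>\<rceil> = int j}" for j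
    define g where "g j \<omega> = f \<omega> * indicator (E j) \<omega>" for j \<omega>
    define Q where "Q j = {\<omega> \<in> space M. q \<omega> \<le> real j / real N}" for j
    have EF: "E j \<in> sets F" for j
      unfolding E_def spF[symmetric] using \<alpha>F by measurable
    have EM [measurable]: "E j \<in> sets M" for j
      using EF sub by (auto simp: subalgebra_def)
    have QM [measurable]: "Q j \<in> sets M" for j unfolding Q_def by measurable
    have gF: "g j \<in> borel_measurable F" for j
      unfolding g_def using fF EF[of j] by measurable
    have g0: "0 \<le> g j \<omega>" for j \<omega> by (simp add: g_def f0)
    have intg: "integrable M (g j)" for j
      unfolding g_def by (rule integrable_real_mult_indicator[OF EM intf])
    have intgQ: "integrable M (\<lambda>\<omega>. g j \<omega> * indicator (Q j) \<omega>)" for j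
      by (rule integrable_real_mult_indicator[OF QM intg])
    \<comment> \<open>As \<open>g j\<close> is \<open>F\<close>-measurable, the indicator of
      \<open>Q j\<close> can be exchanged under the integral for its conditional expectation;
      \<open>j \<le> N\<close> places the point \<open>j / N\<close> in the unit interval, where
      \<open>su\<close> applies.\<close>
    have cell: "(\<integral>\<omega>. g j \<omega> * indicator (Q j) \<omega> \<partial>M) \<le> (\<integral>\<omega>. g j \<omega> * (real j / real N) \<partial>M)"
      if "j \<le> N" for j
    proof -
      have ae: "AE \<omega> in M. real_cond_exp M F (indicator (Q j)) \<omega> \<le> real j / real N"
        unfolding Q_def by (rule su) (use that N in auto)
      have "(\<integral>\<omega>. g j \<omega> * indicator (Q j) \<omega> \<partial>M)
          = (\<integral>\<omega>. g j \<omega> * real_cond_exp M F (indicator (Q j)) \<omega> \<partial>M)"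
        by (rule real_cond_exp_intg(2)[symmetric]) (use intgQ gF in auto)
      also have "\<dots> \<le> (\<integral>\<omega>. g j \<omega> * (real j / real N) \<partial>M)"
      proof (rule integral_mono_AE)
        show "integrable M (\<lambda>\<omega>. g j \<omega> * real_cond_exp M F (indicator (Q j)) \<omega>)"
          by (rule real_cond_exp_intg(1)) (use intgQ gF in auto)
        show "integrable M (\<lambda>\<omega>. g j \<omega> * (real j / real N))" using intg[of j] by simp
        show "AE \<omega> in M. g j \<omega> * real_cond_exp M F (indicator (Q j)) \<omega> \<le> g j \<omega> * (real j / real N)"
          using ae by eventually_elim (rule mult_left_mono[OF _ g0])
      qed
      finally show ?thesis .
    qed
    have round: "\<exists>j\<le>N. \<lceil>real N * \<alpha> \<omega>\<rceil> = int j" "real N * \<alpha> \<omega> \<le> real N" if "\<omega> \<in> space M" for \<omega>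
    proof -
      have b: "0 \<le> \<alpha> \<omega>" "\<alpha> \<omega> \<le> 1" using \<alpha>01[OF that] by auto
      show 1: "real N * \<alpha> \<omega> \<le> real N" using b by (simp add: mult_left_le)
      have "0 \<le> real N * \<alpha> \<omega>" using b by simp
      then have "0 \<le> \<lceil>real N * \<alpha> \<omega>\<rceil>" "\<lceil>real N * \<alpha> \<omega>\<rceil> \<le> int N"
        using 1 by linarith+
      then show "\<exists>j\<le>N. \<lceil>real N * \<alpha> \<omega>\<rceil> = int j"
        by (metis of_nat_le_iff zero_le_imp_eq_int)
    qed
    \<comment> \<open>The cells partition the space, so a single summand survives at each
      point.\<close>
    have collapse: "(\<Sum>j\<le>N. g j \<omega> * h j) = f \<omega> * h i"
      if "\<omega> \<in> space M" "i \<le> N" "\<lceil>real N * \<alpha> \<omega>\<rceil> = int i" for \<omega> i and h :: "nat \<Rightarrow> real"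
    proof -
      have "(\<Sum>j\<le>N. g j \<omega> * h j) = (\<Sum>j\<le>N. if j = i then f \<omega> * h i else 0)"
        using that by (intro sum.cong) (auto simp: g_def E_def indicator_def)
      then show ?thesis using that by simp
    qed
    have "(\<integral>\<omega>. f \<omega> * of_bool (q \<omega> \<le> \<alpha> \<omega>) \<partial>M) \<le> (\<integral>\<omega>. (\<Sum>j\<le>N. g j \<omega> * indicator (Q j) \<omega>) \<partial>M)"
    proof (rule integral_mono)
      show "integrable M (\<lambda>\<omega>. f \<omega> * of_bool (q \<omega> \<le> \<alpha> \<omega>))"
        by (rule Bochner_Integration.integrable_bound[OF intf]) auto
      show "integrable M (\<lambda>\<omega>. \<Sum>j\<le>N. g j \<omega> * indicator (Q j) \<omega>)"
        by (intro Bochner_Integration.integrable_sum intgQ)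
      fix \<omega> assume w: "\<omega> \<in> space M"
      obtain i where i: "i \<le> N" "\<lceil>real N * \<alpha> \<omega>\<rceil> = int i" using round(1)[OF w] by auto
      have "real N * \<alpha> \<omega> \<le> real i" using i(2) by linarith
      then have "\<alpha> \<omega> \<le> real i / real N" using N by (simp add: field_simps)
      then show "f \<omega> * of_bool (q \<omega> \<le> \<alpha> \<omega>) \<le> (\<Sum>j\<le>N. g j \<omega> * indicator (Q j) \<omega>)"
        unfolding collapse[OF w i] using w f0 by (auto simp: Q_def indicator_def)
    qed
    also have "\<dots> = (\<Sum>j\<le>N. \<integral>\<omega>. g j \<omega> * indicator (Q j) \<omega> \<partial>M)"
      using intgQ by (intro Bochner_Integration.integral_sum)
    also have "\<dots> \<le> (\<Sum>j\<le>N. \<integral>\<omega>. g j \<omega> * (real j / real N) \<partial>M)"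
      using cell by (intro sum_mono) auto
    also have "\<dots> = (\<integral>\<omega>. (\<Sum>j\<le>N. g j \<omega> * (real j / real N)) \<partial>M)"
      using intg by (intro Bochner_Integration.integral_sum[symmetric]) auto
    also have "\<dots> \<le> (\<integral>\<omega>. f \<omega> * \<alpha> \<omega> + f \<omega> / real N \<partial>M)"
    proof (rule integral_mono)
      show "integrable M (\<lambda>\<omega>. \<Sum>j\<le>N. g j \<omega> * (real j / real N))" using intg by auto
      show "integrable M (\<lambda>\<omega>. f \<omega> * \<alpha> \<omega> + f \<omega> / real N)" using int\<alpha> intf by auto
      fix \<omega> assume w: "\<omega> \<in> space M"
      obtain i where i: "i \<le> N" "\<lceil>real N * \<alpha> \<omega>\<rceil> = int i" using round(1)[OF w] by auto
      \<comment> \<open>The ceiling adds at most 1; after division by \<open>N\<close> this is the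
        source of the error term.\<close>
      have "real i \<le> real N * \<alpha> \<omega> + 1" using i(2) by linarith
      then have "real i / real N \<le> \<alpha> \<omega> + 1 / real N" using N by (simp add: field_simps)
      then have "f \<omega> * (real i / real N) \<le> f \<omega> * (\<alpha> \<omega> + 1 / real N)"
        by (rule mult_left_mono[OF _ f0])
      then show "(\<Sum>j\<le>N. g j \<omega> * (real j / real N)) \<le> f \<omega> * \<alpha> \<omega> + f \<omega> / real N"
        unfolding collapse[OF w i] by (simp add: algebra_simps)
    qed
    also have "\<dots> = (\<integral>\<omega>. f \<omega> * \<alpha> \<omega> \<partial>M) + expectation f / real N"
      using int\<alpha> intf by simp
    finally show ?thesis .
  qed
  have "(\<lambda>n. (\<integral>\<omega>. f \<omega> * \<alpha> \<omega> \<partial>M) + expectation f * inverse (real (Suc n)))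
      \<longlonglongrightarrow> (\<integral>\<omega>. f \<omega> * \<alpha> \<omega> \<partial>M) + expectation f * 0"
    by (intro tendsto_intros LIMSEQ_inverse_real_of_nat)
  then have "(\<integral>\<omega>. f \<omega> * of_bool (q \<omega> \<le> \<alpha> \<omega>) \<partial>M) \<le> (\<integral>\<omega>. f \<omega> * \<alpha> \<omega> \<partial>M) + expectation f * 0"
    by (rule LIMSEQ_le_const) (use step in \<open>auto simp: field_simps simp del: of_nat_Suc\<close>)
  then show ?thesis by simp
qed

section \<open>The decision filtration and the levels of the union bound\<close>

lemma space_decision_sigma [simp]: "space (decision_sigma M p \<alpha> k) = space M"
  unfolding decision_sigma_def generated_sigma_def by (subst space_measure_of) auto

lemma sets_decision_sigma:
  "sets (decision_sigma M p \<alpha> k) = sigma_sets (space M)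
     (\<Union>i\<in>{1..k}. {(\<lambda>\<omega>. of_bool (p i \<omega> \<le> \<alpha> i \<omega>) :: real) -` B \<inter> space M |B. B \<in> sets borel})"
  unfolding decision_sigma_def generated_sigma_def by (subst sets_measure_of) auto

lemma sets_decision_sigma_mono:
  "j \<le> k \<Longrightarrow> sets (decision_sigma M p \<alpha> j) \<subseteq> sets (decision_sigma M p \<alpha> k)"
  unfolding sets_decision_sigma by (intro sigma_sets_mono' UN_mono) auto

lemma borel_measurable_decision_sigma_mono:
  "j \<le> k \<Longrightarrow> f \<in> borel_measurable (decision_sigma M p \<alpha> j)
    \<Longrightarrow> f \<in> borel_measurable (decision_sigma M p \<alpha> k)"
  using sets_decision_sigma_mono[of j k M p \<alpha>] by (auto simp: measurable_def)

lemma decision_measurable: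
  "i \<in> {1..k} \<Longrightarrow> (\<lambda>\<omega>. of_bool (p i \<omega> \<le> \<alpha> i \<omega>) :: real) \<in> borel_measurable (decision_sigma M p \<alpha> k)"
  unfolding measurable_def sets_decision_sigma space_decision_sigma
  by (intro CollectI conjI funcsetI ballI sigma_sets.Basic UN_I[of i]) auto

text \<open>Euler's value of the sum of the inverse squares is the normalising constant in
  \<open>delta_seq\<close>. The shift to \<open>Suc n\<close> makes the levels start at 1.\<close>

lemma sums_delta_seq: "(\<lambda>n. delta_seq \<delta> (Suc n)) sums \<delta>"
proof -
  have "(\<lambda>n. \<delta> / (pi\<^sup>2 / 6) * (1 / (real n + 1)\<^sup>2)) sums (\<delta> / (pi\<^sup>2 / 6) * (pi\<^sup>2 / 6))"
    using inverse_squares_sums by (intro sums_mult) (simp add: add_ac)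
  then show ?thesis by (simp add: delta_seq_def field_simps)
qed

section \<open>The exponential supermartingale of the false rejections\<close>

locale online_testing = prob_space M for M :: "'a measure" +
  fixes p \<alpha> :: "nat \<Rightarrow> 'a \<Rightarrow> real" and H0 :: "nat set"
  assumes pvalues: "pvalue_sequence M p"
    and procedure: "online_procedure M p \<alpha>"
    and super_uniform: "cond_super_uniform M p \<alpha> H0"
begin

abbreviation G :: "nat \<Rightarrow> 'a measure" where
  "G \<equiv> decision_sigma M p \<alpha>"

text \<open>A real sum of indicators instead of a cardinality, so that measurability follows term by
  term; \<open>card_false_rejections\<close> links it to the count.\<close>

definition false_rejections :: "nat \<Rightarrow> 'a \<Rightarrow> real" where
  "false_rejections k \<omega> = (\<Sum>i\<in>{1..k} \<inter> H0. of_bool (p i \<omega> \<le> \<alpha> i \<omega>))"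

definition spent :: "nat \<Rightarrow> 'a \<Rightarrow> real" where
  "spent k \<omega> = (\<Sum>i=1..k. \<alpha> i \<omega>)"

text \<open>The factor \<open>exp \<theta> - 1\<close> is the log moment generating function at
  \<theta> of a Poisson variable of mean 1. For \<theta> \<ge> 0, a Bernoulli increment of
  conditional mean at most \<alpha> has moment generating function at most
  \<open>1 + (exp \<theta> - 1) * \<alpha>\<close>, hence at most that of a Poisson variable of mean
  \<alpha>.\<close>

definition expmart :: "real \<Rightarrow> nat \<Rightarrow> 'a \<Rightarrow> real" where
  "expmart \<theta> k \<omega> = exp (\<theta> * false_rejections k \<omega> - (exp \<theta> - 1) * spent k \<omega>)"

lemma \<alpha>_bounds: "1 \<le> k \<Longrightarrow> \<omega> \<in> space M \<Longrightarrow> \<alpha> k \<omega> \<in> {0..1}"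
  using procedure by (simp add: online_procedure_def)

lemma \<alpha>_predictable: "\<alpha> (Suc k) \<in> borel_measurable (G k)"
  using procedure by (simp add: online_procedure_def)

text \<open>The generators of \<open>G k\<close> involve the critical values up to time
  \<open>k\<close>, and \<open>\<alpha> i\<close> is known to be measurable only with respect to the
  earlier \<open>G (i - 1)\<close>; hence the strong induction.\<close>

lemma subalgebra_G: "subalgebra M (G k)"
proof (induction k rule: less_induct)
  case (less k)
  have "(\<lambda>\<omega>. of_bool (p i \<omega> \<le> \<alpha> i \<omega>) :: real) \<in> borel_measurable M" if i: "i \<in> {1..k}" for i
  proof -
    obtain j where j: "i = Suc j" using i by (cases i) auto
    have [measurable]: "\<alpha> i \<in> borel_measurable M"
      unfolding j by (rule measurable_from_subalg[OF less.IH \<alpha>_predictable]) (use i j in auto)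
    have [measurable]: "p i \<in> borel_measurable M"
      using pvalues i by (simp add: pvalue_sequence_def)
    show ?thesis by measurable
  qed
  then have "(\<Union>i\<in>{1..k}. {(\<lambda>\<omega>. of_bool (p i \<omega> \<le> \<alpha> i \<omega>) :: real) -` B \<inter> space M |B. B \<in> sets borel})
      \<subseteq> sets M"
    by (auto intro: measurable_sets)
  then show ?case
    unfolding subalgebra_def sets_decision_sigma by (auto dest: sets.sigma_sets_subset)
qed

lemma false_rejections_measurable: "false_rejections k \<in> borel_measurable (G k)"
  unfolding false_rejections_def by (intro borel_measurable_sum decision_measurable) auto

text \<open>Predictability puts the sum one step ahead of the filtration. This lets the
  supermartingale step treat the next critical value as already known.\<close>

lemma spent_measurable: "spent (Suc k) \<in> borel_measurable (G k)"
proof -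
  have "\<alpha> i \<in> borel_measurable (G k)" if i: "i \<in> {1..Suc k}" for i
  proof -
    obtain j where "i = Suc j" "j \<le> k" using i by (cases i) auto
    then show ?thesis using \<alpha>_predictable borel_measurable_decision_sigma_mono by blast
  qed
  then show ?thesis unfolding spent_def by (intro borel_measurable_sum)
qed

lemma spent_measurable': "spent k \<in> borel_measurable (G k)"
proof (cases k)
  case 0
  then show ?thesis by (simp add: spent_def [abs_def])
next
  case (Suc j)
  then show ?thesis using spent_measurable[of j] borel_measurable_decision_sigma_mono[of j k] by auto
qed

lemma spent_nonneg: "\<omega> \<in> space M \<Longrightarrow> 0 \<le> spent k \<omega>"
  unfolding spent_def using \<alpha>_bounds by (intro sum_nonneg) auto

lemma false_rejections_le: "false_rejections k \<omega> \<le> real k"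
proof -
  have "false_rejections k \<omega> \<le> (\<Sum>i\<in>{1..k} \<inter> H0. 1)"
    unfolding false_rejections_def by (intro sum_mono) auto
  also have "\<dots> \<le> real k"
    using card_mono[of "{1..k}" "{1..k} \<inter> H0"] by simp
  finally show ?thesis .
qed

lemma expmart_measurable: "expmart \<theta> k \<in> borel_measurable (G k)"
  unfolding expmart_def using false_rejections_measurable[of k] spent_measurable'[of k] by measurable

text \<open>The compensator is nonnegative and at most \<open>k\<close> rejections have occurred by
  time \<open>k\<close>. The bound serves to make each \<open>expmart \<theta> k\<close>
  integrable.\<close>

lemma expmart_le:
  assumes "0 \<le> \<theta>" "\<omega> \<in> space M"
  shows "expmart \<theta> k \<omega> \<le> exp (\<theta> * real k)"
proof -
  have "0 \<le> (exp \<theta> - 1) * spent k \<omega>" using spent_nonneg assms by simp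
  moreover have "\<theta> * false_rejections k \<omega> \<le> \<theta> * real k"
    using assms false_rejections_le by (intro mult_left_mono)
  ultimately show ?thesis by (simp add: expmart_def)
qed

lemma expmart_integrable: "0 \<le> \<theta> \<Longrightarrow> integrable M (expmart \<theta> k)"
  using expmart_le[of \<theta>] measurable_from_subalg[OF subalgebra_G expmart_measurable[of \<theta> k]]
  by (intro integrable_const_bound[where B = "exp (\<theta> * real k)"]) (auto simp: expmart_def)

text \<open>All factors except the new decision are \<open>G k\<close>-measurable and are collected
  in the weight \<open>f\<close>. For a true null, the new decision enters affinely, so
  super-uniformity replaces it by the critical value; otherwise the count stays the same and only
  the compensator grows. In both cases \<open>1 + u \<le> exp u\<close> restores the factor
  separating \<open>f\<close> from the current value.\<close>

lemma expmart_supermartingale: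
  assumes \<theta>: "0 \<le> \<theta>" and A: "A \<in> sets (G k)"
  shows "(\<integral>\<omega>. indicator A \<omega> * expmart \<theta> (Suc k) \<omega> \<partial>M) \<le> (\<integral>\<omega>. indicator A \<omega> * expmart \<theta> k \<omega> \<partial>M)"
proof -
  define x where "x = exp \<theta> - 1"
  have x0: "0 \<le> x" using \<theta> by (simp add: x_def)
  \<comment> \<open>The count stops at \<open>k\<close>, but the compensator already runs to
    \<open>Suc k\<close>.\<close>
  define f where "f \<omega> = indicator A \<omega> * exp (\<theta> * false_rejections k \<omega> - x * spent (Suc k) \<omega>)" for \<omega>
  define b :: "'a \<Rightarrow> real" where "b \<omega> = of_bool (p (Suc k) \<omega> \<le> \<alpha> (Suc k) \<omega>)" for \<omega>
  have AM: "A \<in> sets M" using A subalgebra_G[of k] by (auto simp: subalgebra_def)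
  have sub: "subalgebra M (G k)" by (rule subalgebra_G)
  have fG: "f \<in> borel_measurable (G k)"
    unfolding f_def using A false_rejections_measurable[of k] spent_measurable[of k] by measurable
  have f0: "0 \<le> f \<omega>" for \<omega> by (simp add: f_def)
  have spent_Suc: "spent (Suc k) \<omega> = spent k \<omega> + \<alpha> (Suc k) \<omega>" for \<omega> by (simp add: spent_def)
  have f_exp: "f \<omega> * exp (x * \<alpha> (Suc k) \<omega>) = indicator A \<omega> * expmart \<theta> k \<omega>" for \<omega>
    unfolding f_def expmart_def x_def[symmetric] spent_Suc
    by (simp add: mult.assoc exp_add[symmetric] algebra_simps)
  have int0: "integrable M (\<lambda>\<omega>. indicator A \<omega> * expmart \<theta> j \<omega>)" for j
    using integrable_real_mult_indicator[OF AM expmart_integrable[OF \<theta>]] by (simp add: mult.commute)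
  have \<alpha>M [measurable]: "\<alpha> (Suc k) \<in> borel_measurable M"
    by (rule measurable_from_subalg[OF sub \<alpha>_predictable])
  have fM [measurable]: "f \<in> borel_measurable M" by (rule measurable_from_subalg[OF sub fG])
  have pM [measurable]: "p (Suc k) \<in> borel_measurable M"
    using pvalues by (simp add: pvalue_sequence_def)
  have bM [measurable]: "b \<in> borel_measurable M" unfolding b_def by measurable
  have \<alpha>01: "0 \<le> \<alpha> (Suc k) \<omega>" "\<alpha> (Suc k) \<omega> \<le> 1" if "\<omega> \<in> space M" for \<omega>
    using \<alpha>_bounds[OF _ that, of "Suc k"] by auto
  have f_le: "f \<omega> \<le> indicator A \<omega> * expmart \<theta> k \<omega>" if "\<omega> \<in> space M" for \<omega>
    unfolding f_exp[symmetric] using \<alpha>01[OF that] x0 f0[of \<omega>]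
    by (auto simp: mult_le_cancel_left1)
  have intf: "integrable M f"
    by (rule Bochner_Integration.integrable_bound[OF int0[of k]])
      (use f_le f0 in \<open>auto simp: expmart_def intro!: AE_I2\<close>)
  have intfb: "integrable M (\<lambda>\<omega>. f \<omega> * b \<omega>)"
    by (rule Bochner_Integration.integrable_bound[OF intf]) (auto simp: b_def)
  have intfa: "integrable M (\<lambda>\<omega>. f \<omega> * \<alpha> (Suc k) \<omega>)"
    by (rule Bochner_Integration.integrable_bound[OF intf])
      (use \<alpha>01 f0 in \<open>auto simp: abs_mult intro!: AE_I2 mult_left_le\<close>)
  have "(\<integral>\<omega>. indicator A \<omega> * expmart \<theta> (Suc k) \<omega> \<partial>M) \<le> (\<integral>\<omega>. f \<omega> + x * (f \<omega> * \<alpha> (Suc k) \<omega>) \<partial>M)"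
  proof (cases "Suc k \<in> H0")
    case True
    have "{1..Suc k} \<inter> H0 = insert (Suc k) ({1..k} \<inter> H0)" using True by auto
    then have V: "false_rejections (Suc k) \<omega> = b \<omega> + false_rejections k \<omega>" for \<omega>
      by (simp add: false_rejections_def b_def)
    \<comment> \<open>\<open>b\<close> takes only the values 0 and 1, so the exponential coincides
      with its linear interpolation.\<close>
    have exp_b: "exp (\<theta> * b \<omega>) = 1 + x * b \<omega>" for \<omega> by (simp add: b_def x_def)
    have eq: "indicator A \<omega> * expmart \<theta> (Suc k) \<omega> = f \<omega> + x * (f \<omega> * b \<omega>)" for \<omega>
    proof -
      have "indicator A \<omega> * expmart \<theta> (Suc k) \<omega> = f \<omega> * exp (\<theta> * b \<omega>)"
        unfolding f_def expmart_def x_def[symmetric] V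
        by (simp add: mult.assoc exp_add[symmetric] algebra_simps)
      then show ?thesis unfolding exp_b by (simp add: algebra_simps)
    qed
    have "(\<integral>\<omega>. f \<omega> * b \<omega> \<partial>M) \<le> (\<integral>\<omega>. f \<omega> * \<alpha> (Suc k) \<omega> \<partial>M)"
      unfolding b_def
    proof (rule super_uniform_predictable_threshold[OF sub pM _ \<alpha>_predictable _ fG f0 intf])
      show "AE \<omega> in M. real_cond_exp M (G k) (indicator {\<omega> \<in> space M. p (Suc k) \<omega> \<le> y}) \<omega> \<le> y"
        if "y \<in> {0..1}" for y
        using super_uniform True that unfolding cond_super_uniform_def by fastforce
    qed (use \<alpha>_bounds in auto)
    then show ?thesis
      unfolding eq using intf intfb intfa x0 by (simp add: mult_left_mono)
  next
    case False
    have "{1..Suc k} \<inter> H0 = {1..k} \<inter> H0" using False by (auto simp: le_Suc_eq)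
    then have eq: "indicator A \<omega> * expmart \<theta> (Suc k) \<omega> = f \<omega>" for \<omega>
      by (simp add: false_rejections_def f_def expmart_def x_def)
    show ?thesis unfolding eq
      using intf intfa x0 f0 \<alpha>01 by (intro integral_mono) auto
  qed
  also have "\<dots> \<le> (\<integral>\<omega>. indicator A \<omega> * expmart \<theta> k \<omega> \<partial>M)"
  proof (rule integral_mono)
    show "integrable M (\<lambda>\<omega>. f \<omega> + x * (f \<omega> * \<alpha> (Suc k) \<omega>))" using intf intfa by auto
    show "integrable M (\<lambda>\<omega>. indicator A \<omega> * expmart \<theta> k \<omega>)" by (rule int0)
    fix \<omega> assume "\<omega> \<in> space M"
    have "f \<omega> * (1 + x * \<alpha> (Suc k) \<omega>) \<le> f \<omega> * exp (x * \<alpha> (Suc k) \<omega>)"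
      by (rule mult_left_mono[OF exp_ge_add_one_self f0])
    then show "f \<omega> + x * (f \<omega> * \<alpha> (Suc k) \<omega>) \<le> indicator A \<omega> * expmart \<theta> k \<omega>"
      unfolding f_exp by (simp add: algebra_simps)
  qed
  finally show ?thesis .
qed

text \<open>Ville's inequality with initial value 1, since both sums in the exponent are empty at
  time 0.\<close>

lemma expmart_crossing:
  assumes "0 \<le> \<theta>" "0 < l"
  shows "l * prob {\<omega> \<in> space M. \<exists>k. l \<le> expmart \<theta> k \<omega>} \<le> 1"
proof -
  have "expectation (expmart \<theta> 0) = 1"
    by (simp add: expmart_def [abs_def] false_rejections_def spent_def prob_space)
  moreover have "l * prob {\<omega> \<in> space M. \<exists>k. l \<le> expmart \<theta> k \<omega>} \<le> expectation (expmart \<theta> 0)"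
  proof (rule ville_inequality[of G])
    show "sets (G k) \<subseteq> sets (G (Suc k))" for k by (rule sets_decision_sigma_mono) simp
    show "0 \<le> expmart \<theta> k \<omega>" for k \<omega> by (simp add: expmart_def)
  qed (use subalgebra_G expmart_measurable expmart_integrable expmart_supermartingale assms in auto)
  ultimately show ?thesis by simp
qed

section \<open>Linear boundaries for the number of false rejections\<close>

text \<open>With \<open>\<theta> = ln (1 + ln (1 / delta_seq \<delta> a) / a)\<close> this is
  \<open>(exp \<theta> - 1) / \<theta>\<close>, the factor of \<open>KRU_term\<close> that depends
  on neither the data nor \<open>k\<close>.\<close>

definition slope :: "real \<Rightarrow> nat \<Rightarrow> real" where
  "slope \<delta> a = ln (1 / delta_seq \<delta> a) / (real a * ln (1 + ln (1 / delta_seq \<delta> a) / real a))"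

text \<open>Crossing the line at some time forces the exponential process to reach
  \<open>1 / delta_seq \<delta> a\<close> at that same time, so one application of the maximal
  inequality covers all \<open>k\<close> at once.\<close>

lemma line_crossing:
  assumes \<delta>: "0 < \<delta>" "\<delta> < 1" and a: "1 \<le> a"
  shows "prob {\<omega> \<in> space M. \<exists>k. slope \<delta> a * (real a + spent k \<omega>) < false_rejections k \<omega>}
    \<le> delta_seq \<delta> a"
proof -
  define L where "L = ln (1 / delta_seq \<delta> a)"
  define \<theta> where "\<theta> = ln (1 + L / real a)"
  note d = delta_seq_bounds[OF \<delta> a]
  have L: "0 < L" unfolding L_def using d by (intro ln_gt_zero) simp
  have x: "0 < L / real a" using L a by simp
  have \<theta>: "0 < \<theta>" unfolding \<theta>_def using x by simp
  have exp\<theta>: "exp \<theta> - 1 = L / real a" unfolding \<theta>_def using x by simp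
  have expL: "exp L = 1 / delta_seq \<delta> a" unfolding L_def using d by simp
  have [measurable]: "expmart \<theta> k \<in> borel_measurable M" for k
    by (rule measurable_from_subalg[OF subalgebra_G expmart_measurable])
  have "{\<omega> \<in> space M. \<exists>k. slope \<delta> a * (real a + spent k \<omega>) < false_rejections k \<omega>}
      \<subseteq> {\<omega> \<in> space M. \<exists>k. 1 / delta_seq \<delta> a \<le> expmart \<theta> k \<omega>}"
  proof safe
    fix \<omega> k assume "slope \<delta> a * (real a + spent k \<omega>) < false_rejections k \<omega>"
    then have "L / (real a * \<theta>) * (real a + spent k \<omega>) < false_rejections k \<omega>"
      by (simp add: slope_def L_def \<theta>_def)
    then have "\<theta> * (L / (real a * \<theta>) * (real a + spent k \<omega>)) < \<theta> * false_rejections k \<omega>"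
      using \<theta> by (rule mult_strict_left_mono)
    \<comment> \<open>The choice of \<theta> gives \<open>exp \<theta> - 1 = L / a\<close>: the
      summand \<open>a\<close> then yields \<open>L\<close>, the logarithm of the level, and the
      summand \<open>spent k \<omega>\<close> yields the compensator.\<close>
    moreover have "\<theta> * (L / (real a * \<theta>) * (real a + spent k \<omega>)) = L + L / real a * spent k \<omega>"
      using \<theta> a by (simp add: field_simps)
    ultimately have "L \<le> \<theta> * false_rejections k \<omega> - (exp \<theta> - 1) * spent k \<omega>"
      unfolding exp\<theta> by linarith
    then show "\<exists>k. 1 / delta_seq \<delta> a \<le> expmart \<theta> k \<omega>"
      unfolding expL[symmetric] expmart_def by auto
  qed
  then have "prob {\<omega> \<in> space M. \<exists>k. slope \<delta> a * (real a + spent k \<omega>) < false_rejections k \<omega>}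
      \<le> prob {\<omega> \<in> space M. \<exists>k. 1 / delta_seq \<delta> a \<le> expmart \<theta> k \<omega>}"
    by (intro finite_measure_mono) auto
  also have "\<dots> \<le> delta_seq \<delta> a"
    using expmart_crossing[of \<theta> "1 / delta_seq \<delta> a"] \<theta> d by (simp add: field_simps)
  finally show ?thesis .
qed

section \<open>From the boundaries to the false discovery proportion\<close>

lemma card_false_rejections:
  "real (card (rejections p \<alpha> k \<omega> \<inter> H0)) = false_rejections k \<omega>"
proof -
  have "rejections p \<alpha> k \<omega> \<inter> H0 = ({1..k} \<inter> H0) \<inter> {i. p i \<omega> \<le> \<alpha> i \<omega>}"
    by (auto simp: rejections_def)
  then show ?thesis by (simp add: false_rejections_def of_bool_def sum.If_cases)
qed

text \<open>The cap at 1 is harmless because the proportion is at most 1, a lower bound of the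
  infimum is a lower bound of every term, and the denominator \<open>max 1 (card R)\<close> is
  common to both sides. An equivalence, because the right side also shows the good event to be
  measurable.\<close>

lemma FDP_le_KRU_bound_iff:
  assumes \<delta>: "0 < \<delta>" "\<delta> < 1" and \<omega>: "\<omega> \<in> space M"
  shows "FDP H0 (rejections p \<alpha> k \<omega>) \<le> KRU_bound \<delta> p \<alpha> k \<omega> \<longleftrightarrow>
    (\<forall>a\<ge>1. false_rejections k \<omega> \<le> slope \<delta> a * (real a + spent k \<omega>))"
proof -
  define R where "R = rejections p \<alpha> k \<omega>"
  have fin: "finite R" by (simp add: R_def rejections_def)
  have m: "0 < real (max 1 (card R))" by simp
  have F: "FDP H0 R = false_rejections k \<omega> / real (max 1 (card R))"
    unfolding FDP_def R_def card_false_rejections by (simp add: max.commute)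
  have "card (R \<inter> H0) \<le> card R" by (rule card_mono[OF fin]) auto
  then have F1: "FDP H0 R \<le> 1" by (auto simp: FDP_def divide_le_eq_1 max_def)
  \<comment> \<open>The reals are only conditionally complete, so comparing with the infimum
    requires a lower bound for its terms.\<close>
  have "bdd_below (KRU_term \<delta> (spent k \<omega>) (card R) ` {1..})"
  proof (rule bdd_belowI2)
    fix a :: nat assume "a \<in> {1..}"
    then have "real a / real (max 1 (card R)) \<le> KRU_term \<delta> (spent k \<omega>) (card R) a"
      by (intro KRU_term_ge[OF \<delta> spent_nonneg[OF \<omega>]]) simp
    then show "0 \<le> KRU_term \<delta> (spent k \<omega>) (card R) a"
      by (rule order_trans[rotated]) simp
  qed
  then have "FDP H0 R \<le> KRU_bound \<delta> p \<alpha> k \<omega> \<longleftrightarrow> (\<forall>a\<ge>1. FDP H0 R \<le> KRU_term \<delta> (spent k \<omega>) (card R) a)"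
    unfolding KRU_bound_def R_def[symmetric] spent_def[symmetric] using F1
    by (auto simp: le_cINF_iff)
  also have "\<dots> \<longleftrightarrow> (\<forall>a\<ge>1. false_rejections k \<omega> \<le> slope \<delta> a * (real a + spent k \<omega>))"
    unfolding F KRU_term_def slope_def[symmetric] times_divide_eq_right
    using m by (simp only: divide_le_cancel) auto
  finally show ?thesis by (simp add: R_def)
qed

text \<open>Uniformity in \<open>k\<close> is already contained in \<open>line_crossing\<close>, so
  the union bound runs over \<open>a\<close> alone, and the levels add up to \<delta>.\<close>

lemma FDP_bound:
  assumes \<delta>: "0 < \<delta>" "\<delta> < 1"
  shows "1 - \<delta> \<le> prob {\<omega> \<in> space M. \<forall>k\<ge>1. FDP H0 (rejections p \<alpha> k \<omega>) \<le> KRU_bound \<delta> p \<alpha> k \<omega>}"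
    (is "_ \<le> prob ?good")
proof -
  \<comment> \<open>Index \<open>n\<close> stands for \<open>a = Suc n\<close>. Time
    \<open>k = 0\<close> is included, which can only enlarge the bad event.\<close>
  define bad where "bad n =
    {\<omega> \<in> space M. \<exists>k. slope \<delta> (Suc n) * (real (Suc n) + spent k \<omega>) < false_rejections k \<omega>}" for n
  have [measurable]: "false_rejections k \<in> borel_measurable M" "spent k \<in> borel_measurable M" for k
    using false_rejections_measurable spent_measurable'
    by (auto intro: measurable_from_subalg[OF subalgebra_G])
  have bad [measurable]: "bad n \<in> sets M" for n unfolding bad_def by measurable
  have good: "?good = {\<omega> \<in> space M. \<forall>k\<ge>1. \<forall>a\<ge>1.
      false_rejections k \<omega> \<le> slope \<delta> a * (real a + spent k \<omega>)}"
    using FDP_le_KRU_bound_iff[OF \<delta>] by blast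
  have good_meas: "?good \<in> sets M" unfolding good by measurable
  have prob_bad: "prob (bad n) \<le> delta_seq \<delta> (Suc n)" for n
    unfolding bad_def by (rule line_crossing[OF \<delta>]) simp
  have sum_d: "summable (\<lambda>n. delta_seq \<delta> (Suc n))" "(\<Sum>n. delta_seq \<delta> (Suc n)) = \<delta>"
    using sums_delta_seq[of \<delta>] by (auto simp: sums_iff)
  have sum_bad: "summable (\<lambda>n. prob (bad n))"
    by (rule summable_comparison_test'[OF sum_d(1), of 0]) (use prob_bad in auto)
  have "space M - ?good \<subseteq> (\<Union>n. bad n)"
  proof
    fix \<omega> assume "\<omega> \<in> space M - ?good"
    then obtain k a where w: "\<omega> \<in> space M" "1 \<le> a"
      "slope \<delta> a * (real a + spent k \<omega>) < false_rejections k \<omega>"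
      unfolding good by (auto simp: not_le)
    moreover obtain n where "a = Suc n" using w(2) by (cases a) auto
    ultimately show "\<omega> \<in> (\<Union>n. bad n)" unfolding bad_def by blast
  qed
  then have "prob (space M - ?good) \<le> prob (\<Union>n. bad n)"
    by (intro finite_measure_mono) auto
  also have "\<dots> \<le> (\<Sum>n. prob (bad n))"
    by (rule finite_measure_subadditive_countably[OF _ sum_bad]) auto
  also have "\<dots> \<le> \<delta>"
    using suminf_le[OF prob_bad sum_bad sum_d(1)] sum_d(2) by simp
  finally show ?thesis using prob_compl[OF good_meas] by simp
qed

end

theorem theorem27:
  fixes M :: "'a measure" and p \<alpha> :: "nat \<Rightarrow> 'a \<Rightarrow> real"
    and H0 :: "nat set" and \<delta> :: real
  assumes "prob_space M"
    and "H0 \<subseteq> {1..}"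
    and "pvalue_sequence M p"
    and "online_procedure M p \<alpha>"
    and "cond_super_uniform M p \<alpha> H0"
    and "0 < \<delta>" and "\<delta> < 1"
  shows "measure M {\<omega> \<in> space M.
           \<forall>k\<ge>1. FDP H0 (rejections p \<alpha> k \<omega>) \<le> KRU_bound \<delta> p \<alpha> k \<omega>} \<ge> 1 - \<delta>"
proof -
  interpret prob_space M by fact
  interpret online_testing M p \<alpha> H0 by unfold_locales fact+
  show ?thesis by (rule FDP_bound) fact+
qed

end
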